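(* Let $(X_i,\kappa_i)$ be digital images, $i\in\{1,2,\ldots,v\}$. Then $(X_i,\kappa_i)$ is connected for all $i$ if and only if $\big(\prod_{i=1}^v X_i,\ NP_v(\kappa_1,\ldots,\kappa_v)\big)$ is connected.
   Context: Here $v$ is a positive integer. A digital image $(X,\kappa)$ is a set $X$ (of lattice points in some $\mathbb{Z}^n$) with an adjacency relation $\kappa$, i.e. a symmetric irreflexive binary relation on $X$. It is connected if for every pair of points $a,b\in X$ there is a finite sequence $a=y_0,\dots,y_m=b$ in $X$ with $y_i,y_{i+1}$ $\kappa$-adjacent for $0\le i<m$. $NP_v(\kappa_1,\dots,\kappa_v)$-adjacency on $\prod_{i=1}^v X_i$: points $(x_1,\dots,x_v)$ and $(x_1',\dots,x_v')$ are adjacent if and only if for at least 1 and at most $v$ indices $i$, $x_i$ and $x_i'$ are $\kappa_i$-adjacent, and for all other indices $i$, $x_i=x_i'$.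
   Formalization: Each digital image X_i is assumed non-empty; otherwise the claim fails, e.g. for v = 2 with X_1 empty and X_2 two non-adjacent points, where the product is empty and hence connected but X_2 is not. *)

theory Defs
  imports Main "HOL-Library.FuncSet"
begin

(* Points of Z^n are the integer lists of length n. The values of kap outside X are
   irrelevant: everything below uses it only between points of X. *)
definition digital_image :: "int list set \<Rightarrow> (int list \<Rightarrow> int list \<Rightarrow> bool) \<Rightarrow> bool" where
  "digital_image X kap \<longleftrightarrow>
     (\<exists>n. X \<subseteq> {p. length p = n}) \<and> symp_on X kap \<and> irreflp_on X kap"

definition digitally_connected :: "'a set \<Rightarrow> ('a \<Rightarrow> 'a \<Rightarrow> bool) \<Rightarrow> bool" where
  "digitally_connected X kap \<longleftrightarrow>
     (\<forall>a\<in>X. \<forall>b\<in>X. \<exists>(m::nat) y. y 0 = a \<and> y m = b \<and>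
        (\<forall>i\<le>m. y i \<in> X) \<and> (\<forall>i<m. kap (y i) (y (Suc i))))"

(* A tuple (x_1,...,x_v) is a function on the index set {1..v}. J is the set of
   indices at which the coordinates are required to be adjacent. *)
definition NP :: "nat \<Rightarrow> (nat \<Rightarrow> 'a \<Rightarrow> 'a \<Rightarrow> bool) \<Rightarrow> (nat \<Rightarrow> 'a) \<Rightarrow> (nat \<Rightarrow> 'a) \<Rightarrow> bool" where
  "NP v kap x x' \<longleftrightarrow>
     (\<exists>J\<subseteq>{1..v}. 1 \<le> card J \<and> card J \<le> v \<and>
        (\<forall>i\<in>J. kap i (x i) (x' i)) \<and> (\<forall>i\<in>{1..v} - J. x i = x' i))"

end

(* Connectedness is reachability in the reflexive transitive closure of the adjacency restricted
   to the image. Moving a single coordinate along a path is a path in the product, so points are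
   joined coordinate by coordinate; conversely, each coordinate projection sends an adjacent pair
   to an adjacent or equal pair, so it carries paths to paths. *)
theory Submission
  imports Defs
begin

definition adj_on :: "'a set \<Rightarrow> ('a \<Rightarrow> 'a \<Rightarrow> bool) \<Rightarrow> 'a \<Rightarrow> 'a \<Rightarrow> bool" where
  "adj_on X kap x y \<longleftrightarrow> x \<in> X \<and> y \<in> X \<and> kap x y"

text \<open>The premise on \<open>a\<close> matters for paths of length zero: the closure relates
  every point to itself, even outside \<open>X\<close>, while a path must lie in
  \<open>X\<close>.\<close>

lemma rtranclp_adj_on_iff:
  assumes "a \<in> X"
  shows "(adj_on X kap)\<^sup>*\<^sup>* a b \<longleftrightarrow>
    (\<exists>(m::nat) y. y 0 = a \<and> y m = b \<and> (\<forall>i\<le>m. y i \<in> X) \<and> (\<forall>i<m. kap (y i) (y (Suc i))))"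
    (is "?L \<longleftrightarrow> ?R")
proof
  assume ?L
  then obtain m y where y: "y 0 = a" "y m = b" "\<And>i. i < m \<Longrightarrow> adj_on X kap (y i) (y (Suc i))"
    by (auto simp: rtranclp_power relpowp_fun_conv)
  \<comment> \<open>Each point after the start is the target of a step, hence in \<open>X\<close>;
    the start is \<open>a\<close>.\<close>
  have "y i \<in> X" if "i \<le> m" for i
    using that y assms by (cases i) (auto simp: adj_on_def Suc_le_eq)
  with y show ?R
    by (auto simp: adj_on_def)
next
  assume ?R
  then obtain m :: nat and y where "y 0 = a" "y m = b"
    "\<forall>i\<le>m. y i \<in> X" "\<forall>i<m. kap (y i) (y (Suc i))"
    by blast
  then have "(adj_on X kap ^^ m) a b"
    by (auto simp: relpowp_fun_conv adj_on_def intro!: exI[of _ y])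
  then show ?L
    by (rule relpowp_imp_rtranclp)
qed

lemma digitally_connected_iff:
  "digitally_connected X kap \<longleftrightarrow> (\<forall>a\<in>X. \<forall>b\<in>X. (adj_on X kap)\<^sup>*\<^sup>* a b)"
  by (simp add: digitally_connected_def rtranclp_adj_on_iff)

lemma NP_fun_upd:
  assumes "i \<in> {1..v}" "kap i c d"
  shows "NP v kap (x(i := c)) (x(i := d))"
  unfolding NP_def using assms by (intro exI[of _ "{i}"]) auto

lemma NP_coordinate:
  assumes "NP v kap x y" "i \<in> {1..v}"
  shows "kap i (x i) (y i) \<or> x i = y i"
  using assms unfolding NP_def by blast

lemma PiE_fun_upd_mem:
  assumes "x \<in> PiE I X" "i \<in> I" "c \<in> X i"
  shows "x(i := c) \<in> PiE I X"
  using PiE_fun_upd[of c X i x I] assms by (simp add: insert_absorb)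

text \<open>Each step from \<open>c\<close> to \<open>d\<close> lifts to a product step with
  \<open>J = {i}\<close>, the other coordinates staying frozen at those of \<open>x\<close>. Writing
  both ends as updates of \<open>x\<close> lets the induction vary only the second value.\<close>

lemma NP_reach_fun_upd:
  assumes "(adj_on (X i) (kap i))\<^sup>*\<^sup>* c d" "x \<in> PiE {1..v} X" "i \<in> {1..v}"
  shows "(adj_on (PiE {1..v} X) (NP v kap))\<^sup>*\<^sup>* (x(i := c)) (x(i := d))"
  using assms(1)
proof induction
  case (step d e)
  then have "adj_on (PiE {1..v} X) (NP v kap) (x(i := d)) (x(i := e))"
    using assms(2,3) NP_fun_upd[of i v kap d e x] PiE_fun_upd_mem[of x "{1..v}" X i]
    by (simp add: adj_on_def)
  with step.IH show ?case by (meson rtranclp.rtrancl_into_rtrancl)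
qed simp

text \<open>A product step either moves coordinate \<open>i\<close> along an edge or leaves it
  fixed, and the reflexive closure absorbs the second case.\<close>

lemma NP_reach_coordinate:
  assumes "(adj_on (PiE {1..v} X) (NP v kap))\<^sup>*\<^sup>* x y" "i \<in> {1..v}"
  shows "(adj_on (X i) (kap i))\<^sup>*\<^sup>* (x i) (y i)"
  using assms(1)
proof induction
  case (step y z)
  then have "y i \<in> X i" "z i \<in> X i" "kap i (y i) (z i) \<or> y i = z i"
    using assms(2) NP_coordinate[of v kap y z i] by (auto simp: adj_on_def)
  with step.IH show ?case
    by (metis adj_on_def rtranclp.rtrancl_into_rtrancl)
qed simp

text \<open>Induction on the set \<open>S\<close> of coordinates already switched from
  \<open>x\<close> to \<open>y\<close>; every intermediate tuple stays in the product.\<close>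

lemma NP_reach_override_on:
  assumes conn: "\<And>i. i \<in> {1..v} \<Longrightarrow> digitally_connected (X i) (kap i)"
    and x: "x \<in> PiE {1..v} X" and y: "y \<in> PiE {1..v} X"
    and S: "finite S" "S \<subseteq> {1..v}"
  shows "(adj_on (PiE {1..v} X) (NP v kap))\<^sup>*\<^sup>* x (override_on x y S)"
  using S
proof (induction S rule: finite_induct)
  case (insert i S)
  let ?z = "override_on x y S"
  have i: "i \<in> {1..v}" using insert.prems by simp
  have "?z \<in> PiE {1..v} X"
    using x y by (auto simp: PiE_iff override_on_def extensional_def)
  moreover have "(adj_on (X i) (kap i))\<^sup>*\<^sup>* (?z i) (y i)"
    using conn[OF i] i y \<open>?z \<in> PiE {1..v} X\<close>
    unfolding digitally_connected_iff by (blast dest: PiE_mem)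
  \<comment> \<open>The target is the override on \<open>insert i S\<close>; the source is
    \<open>?z\<close> because updating \<open>i\<close> by \<open>?z i\<close> changes
    nothing.\<close>
  ultimately have "(adj_on (PiE {1..v} X) (NP v kap))\<^sup>*\<^sup>* ?z (?z(i := y i))"
    using NP_reach_fun_upd[of X i kap "?z i" "y i" ?z v] i by simp
  with insert show ?case
    unfolding override_on_insert by (meson insert_subset rtranclp_trans)
qed simp

theorem theorem5p1:
  fixes v :: nat
    and X :: "nat \<Rightarrow> int list set"
    and kap :: "nat \<Rightarrow> int list \<Rightarrow> int list \<Rightarrow> bool"
  assumes "v \<ge> 1"
    and "\<And>i. i \<in> {1..v} \<Longrightarrow> digital_image (X i) (kap i)"
    and "\<And>i. i \<in> {1..v} \<Longrightarrow> X i \<noteq> {}"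
  shows "(\<forall>i\<in>{1..v}. digitally_connected (X i) (kap i)) \<longleftrightarrow>
         digitally_connected (\<Pi>\<^sub>E i\<in>{1..v}. X i) (NP v kap)"
proof
  assume conn: "\<forall>i\<in>{1..v}. digitally_connected (X i) (kap i)"
  show "digitally_connected (\<Pi>\<^sub>E i\<in>{1..v}. X i) (NP v kap)"
    unfolding digitally_connected_iff
  proof (intro ballI)
    fix x y assume xy: "x \<in> (\<Pi>\<^sub>E i\<in>{1..v}. X i)" "y \<in> (\<Pi>\<^sub>E i\<in>{1..v}. X i)"
    \<comment> \<open>Outside \<open>{1..v}\<close> both tuples are \<open>undefined\<close>, so
      they agree there as well.\<close>
    then have "override_on x y {1..v} = y"
      by (auto simp: PiE_iff override_on_def extensional_def)
    then show "(adj_on (\<Pi>\<^sub>E i\<in>{1..v}. X i) (NP v kap))\<^sup>*\<^sup>* x y"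
      using NP_reach_override_on[of v X kap x y "{1..v}"] conn xy by simp
  qed
next
  assume conn: "digitally_connected (\<Pi>\<^sub>E i\<in>{1..v}. X i) (NP v kap)"
  \<comment> \<open>A base point exists only because all factors are nonempty. It embeds
    \<open>a\<close> and \<open>b\<close> as product points differing at most in coordinate
    \<open>i\<close>. With an empty factor the product would be vacuously connected, whatever the
    other factors are.\<close>
  obtain z where z: "z \<in> (\<Pi>\<^sub>E i\<in>{1..v}. X i)"
    using assms(3) PiE_eq_empty_iff[of "{1..v}" X] by blast
  show "\<forall>i\<in>{1..v}. digitally_connected (X i) (kap i)"
    unfolding digitally_connected_iff
  proof (intro ballI)
    fix i a b assume i: "i \<in> {1..v}" and "a \<in> X i" "b \<in> X i"
    then have "(adj_on (\<Pi>\<^sub>E i\<in>{1..v}. X i) (NP v kap))\<^sup>*\<^sup>* (z(i := a)) (z(i := b))"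
      using conn z PiE_fun_upd_mem[of z "{1..v}" X i] unfolding digitally_connected_iff by blast
    then show "(adj_on (X i) (kap i))\<^sup>*\<^sup>* a b"
      using NP_reach_coordinate[of v X kap "z(i := a)" "z(i := b)" i] i by simp
  qed
qed

end
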